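(* Let $\phi:R\to S$ be a homomorphism of rings. If $I$ is an N-pure ideal of $R$, then $IS$ is an N-pure ideal of $S$.
   Context: All rings are commutative with identity. $N(A)$ denotes the nilradical of a ring $A$. An ideal $I$ of a ring $A$ is called N-pure if for every $a\in I$ there exists $b\in I$ such that $a(1-b)\in N(A)$. $IS$ denotes the ideal of $S$ generated by $\phi(I)$. *)

theory Defs
  imports "HOL-Algebra.Ideal"
begin

definition nilradical :: "('a, 'm) ring_scheme \<Rightarrow> 'a set"
  where "nilradical A = {x \<in> carrier A. \<exists>n::nat. x [^]\<^bsub>A\<^esub> n = \<zero>\<^bsub>A\<^esub>}"

definition N_pure_ideal :: "'a set \<Rightarrow> ('a, 'm) ring_scheme \<Rightarrow> bool"
  where "N_pure_ideal I A \<longleftrightarrow>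
    ideal I A \<and>
    (\<forall>a\<in>I. \<exists>b\<in>I. a \<otimes>\<^bsub>A\<^esub> (\<one>\<^bsub>A\<^esub> \<ominus>\<^bsub>A\<^esub> b) \<in> nilradical A)"

definition extended_ideal ::
  "('b, 'n) ring_scheme \<Rightarrow> ('a \<Rightarrow> 'b) \<Rightarrow> 'a set \<Rightarrow> 'b set"
  where "extended_ideal S \<phi> I = Idl\<^bsub>S\<^esub> (\<phi> ` I)"

end

theory Submission
  imports Defs "HOL-Algebra.RingHom"
begin

text \<open>
  Fix an ideal \<open>J\<close> of a commutative ring. The elements \<open>x\<close> for which some \<open>b \<in> J\<close> makes
  \<open>x (1 - b)\<close> nilpotent form an ideal. The reason is that \<open>1 - J\<close> is closed under multiplication,
  so that witnesses \<open>b\<close> and \<open>c\<close> for two elements combine to \<open>b + c - bc\<close>, where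
  \<open>1 - (b + c - bc) = (1 - b) (1 - c)\<close>, and that the nilpotent elements form an ideal.
  Consequently N-purity of an ideal may be tested on any generating set
  (\<open>N_pure_ideal_if_generators\<close>).

  For the extended ideal the generators are the images \<open>\<phi> a\<close> with \<open>a \<in> I\<close>. A witness \<open>b \<in> I\<close> for
  \<open>a\<close> yields the witness \<open>\<phi> b\<close> for \<open>\<phi> a\<close>, because a ring homomorphism maps the nilpotent element
  \<open>a (1 - b)\<close> to the nilpotent element \<open>\<phi> a (1 - \<phi> b)\<close>.
\<close>

text \<open>
  This takes the place of the binomial theorem in showing that sums of nilpotents are nilpotent: expanding
  one factor \<open>u + v\<close> moves one unit from the exponent \<open>k\<close> to \<open>i\<close> or to \<open>j\<close>, and once \<open>k = 0\<close> the
  bound forces \<open>m \<le> i\<close> or \<open>n \<le> j\<close>.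
\<close>

lemma (in cring) mixed_power_of_nilpotents_zero:
  fixes m n i j k :: nat
  assumes u: "u \<in> carrier R" and v: "v \<in> carrier R"
    and um: "u [^] m = \<zero>" and vn: "v [^] n = \<zero>"
    and "m + n \<le> i + j + k"
  shows "(u [^] i \<otimes> v [^] j) \<otimes> (u \<oplus> v) [^] k = \<zero>"
  using assms(5)
proof (induction k arbitrary: i j)
  case 0
  then consider "m \<le> i" | "n \<le> j" by linarith
  then show ?case
  proof cases
    case 1
    then have "u [^] i = u [^] m \<otimes> u [^] (i - m)" by (simp add: nat_pow_mult u)
    then show ?thesis using u v um by simp
  next
    case 2
    then have "v [^] j = v [^] n \<otimes> v [^] (j - n)" by (simp add: nat_pow_mult v)
    then show ?thesis using u v vn by simp
  qed
next
  case (Suc k)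
  let ?s = "(u \<oplus> v) [^] k"
  have "(u [^] i \<otimes> v [^] j) \<otimes> (u \<oplus> v) [^] Suc k =
      (u [^] Suc i \<otimes> v [^] j) \<otimes> ?s \<oplus> (u [^] i \<otimes> v [^] Suc j) \<otimes> ?s"
    using u v by (simp add: r_distr l_distr m_ac)
  also have "\<dots> = \<zero>"
    using Suc.IH[of "Suc i" j] Suc.IH[of i "Suc j"] Suc.prems by simp
  finally show ?case .
qed

lemma (in cring) nilradical_add:
  assumes "u \<in> nilradical R" "v \<in> nilradical R"
  shows "u \<oplus> v \<in> nilradical R"
proof -
  from assms obtain m n :: nat where uv: "u \<in> carrier R" "v \<in> carrier R"
    and mn: "u [^] m = \<zero>" "v [^] n = \<zero>"
    unfolding nilradical_def by blast
  have "(u \<oplus> v) [^] (m + n) = \<zero>"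
    using mixed_power_of_nilpotents_zero[OF uv mn, of 0 0 "m + n"] uv by simp
  with uv show ?thesis unfolding nilradical_def by blast
qed

lemma (in cring) nilradical_mult:
  assumes "u \<in> nilradical R" "r \<in> carrier R"
  shows "u \<otimes> r \<in> nilradical R"
proof -
  from assms obtain n :: nat where u: "u \<in> carrier R" and n: "u [^] n = \<zero>"
    unfolding nilradical_def by blast
  have "(u \<otimes> r) [^] n = \<zero>" using u n assms(2) by (simp add: nat_pow_distrib)
  with u assms(2) show ?thesis unfolding nilradical_def by blast
qed

lemma (in ring_hom_ring) hom_nilradical:
  assumes "x \<in> nilradical R"
  shows "h x \<in> nilradical S"
proof -
  from assms obtain n :: nat where x: "x \<in> carrier R" and n: "x [^] n = \<zero>"
    unfolding nilradical_def by blast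
  have "h x [^]\<^bsub>S\<^esub> n = h (x [^] n)" using x by (simp add: hom_nat_pow)
  then have "h x [^]\<^bsub>S\<^esub> n = \<zero>\<^bsub>S\<^esub>" using n by simp
  moreover have "h x \<in> carrier S" using x by simp
  ultimately show ?thesis unfolding nilradical_def by blast
qed

text \<open>
  This ideal consists of the elements that become nilpotent after localization at the
  multiplicative set \<open>1 - J\<close>.
\<close>

lemma (in cring) ideal_nilpotent_modulo_one_minus:
  assumes J: "ideal J R"
  shows "ideal {x \<in> carrier R. \<exists>b\<in>J. x \<otimes> (\<one> \<ominus> b) \<in> nilradical R} R"
    (is "ideal ?K R")
proof -
  interpret J: ideal J R by (rule J)
  have mult: "x \<otimes> r \<in> ?K" if x: "x \<in> ?K" and r: "r \<in> carrier R" for x r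
  proof -
    from x obtain b where b: "b \<in> J" and xc: "x \<in> carrier R"
      and nil: "x \<otimes> (\<one> \<ominus> b) \<in> nilradical R" by blast
    have "(x \<otimes> r) \<otimes> (\<one> \<ominus> b) = (x \<otimes> (\<one> \<ominus> b)) \<otimes> r"
      using xc r b by (simp add: m_ac)
    then have "(x \<otimes> r) \<otimes> (\<one> \<ominus> b) \<in> nilradical R" using nilradical_mult[OF nil r] by simp
    with xc r b show ?thesis by blast
  qed
  have add: "x \<oplus> y \<in> ?K" if x: "x \<in> ?K" and y: "y \<in> ?K" for x y
  proof -
    from x obtain b where b: "b \<in> J" and xc: "x \<in> carrier R"
      and nilx: "x \<otimes> (\<one> \<ominus> b) \<in> nilradical R" by blast
    from y obtain c where c: "c \<in> J" and yc: "y \<in> carrier R"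
      and nily: "y \<otimes> (\<one> \<ominus> c) \<in> nilradical R" by blast
    note bc = J.Icarr[OF b] J.Icarr[OF c]
    let ?d = "b \<oplus> c \<otimes> (\<one> \<ominus> b)"
    have d: "?d \<in> J" using b c bc by (simp add: J.I_r_closed)
    have one_minus_d: "\<one> \<ominus> ?d = (\<one> \<ominus> b) \<otimes> (\<one> \<ominus> c)"
      using bc by algebra
    have "(x \<oplus> y) \<otimes> (\<one> \<ominus> ?d) =
        x \<otimes> (\<one> \<ominus> b) \<otimes> (\<one> \<ominus> c) \<oplus> y \<otimes> (\<one> \<ominus> c) \<otimes> (\<one> \<ominus> b)"
      unfolding one_minus_d using xc yc bc by (simp add: l_distr m_ac)
    also have "\<dots> \<in> nilradical R"
      using nilx nily bc by (simp add: nilradical_add nilradical_mult)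
    finally show ?thesis using d xc yc by blast
  qed
  have zero_J: "\<zero> \<in> J"
    by (rule additive_subgroup.zero_closed[OF J.additive_subgroup_axioms])
  have "\<zero> \<otimes> (\<one> \<ominus> \<zero>) \<in> nilradical R"
    unfolding nilradical_def by (auto intro: exI[of _ "1::nat"])
  then have zero: "\<zero> \<in> ?K" using zero_J by blast
  have neg: "\<ominus> x \<in> ?K" if x: "x \<in> ?K" for x
    using mult[OF x, of "\<ominus> \<one>"] x by (simp add: r_minus)
  show ?thesis
  proof (rule idealI)
    show "subgroup ?K (add_monoid R)"
    proof (rule add.subgroupI)
      show "?K \<noteq> {}" using zero by blast
    qed (use neg add in \<open>auto simp only: a_inv_def\<close>)
  qed (use mult m_comm ring_axioms in auto)
qed

lemma (in cring) N_pure_ideal_if_generators: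
  assumes H: "H \<subseteq> carrier R"
    and gen: "\<And>h. h \<in> H \<Longrightarrow> \<exists>b\<in>Idl H. h \<otimes> (\<one> \<ominus> b) \<in> nilradical R"
  shows "N_pure_ideal (Idl H) R"
proof -
  have J: "ideal (Idl H) R" by (rule genideal_ideal[OF H])
  have "Idl H \<subseteq> {x \<in> carrier R. \<exists>b\<in>Idl H. x \<otimes> (\<one> \<ominus> b) \<in> nilradical R}"
    by (rule genideal_minimal[OF ideal_nilpotent_modulo_one_minus[OF J]])
      (use H gen in blast)
  with J show ?thesis unfolding N_pure_ideal_def by blast
qed

theorem lemma3p12:
  fixes R :: "('a, 'm) ring_scheme"
    and S :: "('b, 'n) ring_scheme"
    and \<phi> :: "'a \<Rightarrow> 'b"
    and I :: "'a set"
  assumes "cring R"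
    and "cring S"
    and "\<phi> \<in> ring_hom R S"
    and "N_pure_ideal I R"
  shows "N_pure_ideal (extended_ideal S \<phi> I) S"
proof -
  interpret R: cring R by fact
  interpret S: cring S by fact
  interpret \<phi>: ring_hom_ring R S \<phi>
    by (rule ring_hom_ringI2[OF R.ring_axioms S.ring_axioms assms(3)])
  interpret I: ideal I R using assms(4) unfolding N_pure_ideal_def by blast
  have sub: "\<phi> ` I \<subseteq> carrier S" using I.Icarr by auto
  show ?thesis
    unfolding extended_ideal_def
  proof (rule S.N_pure_ideal_if_generators[OF sub])
    fix h assume "h \<in> \<phi> ` I"
    then obtain a where a: "a \<in> I" and h: "h = \<phi> a" by blast
    with assms(4) obtain b where b: "b \<in> I"
      and nil: "a \<otimes>\<^bsub>R\<^esub> (\<one>\<^bsub>R\<^esub> \<ominus>\<^bsub>R\<^esub> b) \<in> nilradical R"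
      unfolding N_pure_ideal_def by blast
    note ab = I.Icarr[OF a] I.Icarr[OF b]
    have "\<phi> (a \<otimes>\<^bsub>R\<^esub> (\<one>\<^bsub>R\<^esub> \<ominus>\<^bsub>R\<^esub> b)) = h \<otimes>\<^bsub>S\<^esub> (\<one>\<^bsub>S\<^esub> \<ominus>\<^bsub>S\<^esub> \<phi> b)"
      using ab h by (simp add: a_minus_def)
    then have "h \<otimes>\<^bsub>S\<^esub> (\<one>\<^bsub>S\<^esub> \<ominus>\<^bsub>S\<^esub> \<phi> b) \<in> nilradical S"
      using \<phi>.hom_nilradical[OF nil] by simp
    moreover have "\<phi> b \<in> Idl\<^bsub>S\<^esub> (\<phi> ` I)" using S.genideal_self[OF sub] b by blast
    ultimately show "\<exists>b\<in>Idl\<^bsub>S\<^esub> (\<phi> ` I). h \<otimes>\<^bsub>S\<^esub> (\<one>\<^bsub>S\<^esub> \<ominus>\<^bsub>S\<^esub> b) \<in> nilradical S"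
      by blast
  qed
qed

end
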